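(* Let $n,d\ge 1$ and let $\mathbf{f}=(f_1,\dots,f_n):\mathbb{R}^n\to\mathbb{R}^n$ be the polynomial vector field $$\dot x_i=f_i(\mathbf{x})=\sum_{|\mathbf{k}|=1}^{d} a^i_{\mathbf{k}}\,\mathbf{x}^{\mathbf{k}},\qquad i=1,\dots,n,$$ with real coefficients $a^i_{\mathbf{k}}$, the sum running over multi-indices $\mathbf{k}\in\mathbb{N}^n$ with $1\le|\mathbf{k}|\le d$. Assume that the vector field is diagonal and divergence-free. Let $$P_{d-1}(\mathbf{x})=\sum_{|\mathbf{j}|=0}^{d-1}p_{\mathbf{j}}\,\mathbf{x}^{\mathbf{j}}$$ be the divergence of $\mathbf{f}$. For each multi-index $\mathbf{j}\in\mathbb{N}^n$ with $0\le|\mathbf{j}|\le d-1$ consider the polynomial vector field $$\dot x_i=a^i_{\mathbf{j}+\mathbf{e}_i}\,x_i\,\mathbf{x}^{\mathbf{j}},\qquad 1\le i\le n. \qquad ( * )$$ Then each vector field $( * )$ is divergence-free. Moreover, $\mathbf{f}$ can be uniquely split as a sum of vector fields of the form $( * )$, one for each $\mathbf{j}$; that is, $\mathbf{f}$ is the sum of the fields $( * )$ over all $\mathbf{j}$ with $0\le|\mathbf{j}|\le d-1$, and this is the only way to write $\mathbf{f}$ as $\sum_{0\le|\mathbf{j}|\le d-1}G_{\mathbf{j}}$ with each $G_{\mathbf{j}}$ of the form $(G_{\mathbf{j}})_i(\mathbf{x})=c^i_{\mathbf{j}}\,x_i\,\mathbf{x}^{\mathbf{j}}$, where $c^i_{\mathbf{j}}\in\mathbb{R}$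 are constants.
   Context: Here $\mathbb{N}$ includes $0$. For a multi-index $\mathbf{j}=(j_1,\dots,j_n)\in\mathbb{N}^n$, $\mathbf{x}^{\mathbf{j}}=x_1^{j_1}\cdots x_n^{j_n}$ and $|\mathbf{j}|=j_1+\cdots+j_n$. $\mathbf{e}_i$ is the $i$-th canonical unit vector of $\mathbb{R}^n$. A vector field $\mathbf{f}$ is divergence-free if $\nabla\cdot\mathbf{f}=\sum_{i=1}^n\partial_{x_i}f_i(\mathbf{x})=0$ identically. The polynomial vector field is called diagonal if every term of $f_i$ depends on $x_i$, for each $i$, i.e. $a^i_{\mathbf{k}}\neq 0$ only if $k_i\neq 0$. *)

theory Defs
  imports "HOL-Analysis.Analysis"
begin

type_synonym 'n mindex = "nat ^ 'n"

definition mdeg :: "'n::finite mindex \<Rightarrow> nat"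
  where "mdeg k = (\<Sum>i\<in>UNIV. k $ i)"

definition mpower :: "real ^ 'n::finite \<Rightarrow> 'n mindex \<Rightarrow> real"
  where "mpower x k = (\<Prod>i\<in>UNIV. x $ i ^ k $ i)"

definition mindices :: "nat \<Rightarrow> nat \<Rightarrow> 'n::finite mindex set"
  where "mindices m d = {k. m \<le> mdeg k \<and> mdeg k \<le> d}"

lemma finite_mindices: "finite (mindices m d :: 'n::finite mindex set)"
proof (rule finite_imageD)
  have "vec_nth ` (mindices m d :: 'n mindex set) \<subseteq> (UNIV :: 'n set) \<rightarrow>\<^sub>E {..d}"
  proof
    fix f assume "f \<in> vec_nth ` (mindices m d :: 'n mindex set)"
    then obtain k :: "'n mindex" where f: "f = vec_nth k" and k: "mdeg k \<le> d"
      by (auto simp: mindices_def)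
    have "k $ i \<le> mdeg k" for i
      unfolding mdeg_def by (rule member_le_sum) auto
    then show "f \<in> (UNIV :: 'n set) \<rightarrow>\<^sub>E {..d}"
      using k f by (auto intro: order_trans)
  qed
  then show "finite (vec_nth ` (mindices m d :: 'n mindex set))"
    by (rule finite_subset) (auto intro: finite_PiE)
  show "inj_on vec_nth (mindices m d :: 'n mindex set)"
    by (auto simp: inj_on_def vec_nth_inject)
qed

definition partial_deriv :: "'n::finite \<Rightarrow> (real ^ 'n \<Rightarrow> real) \<Rightarrow> real ^ 'n \<Rightarrow> real"
  where "partial_deriv i g x = deriv (\<lambda>t. g (x + t *\<^sub>R axis i 1)) 0"

definition divergence :: "(real ^ 'n::finite \<Rightarrow> real ^ 'n) \<Rightarrow> real ^ 'n \<Rightarrow> real"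
  where "divergence f x = (\<Sum>i\<in>UNIV. partial_deriv i (\<lambda>y. f y $ i) x)"

definition divergence_free :: "(real ^ 'n::finite \<Rightarrow> real ^ 'n) \<Rightarrow> bool"
  where "divergence_free f \<longleftrightarrow> (\<forall>x. divergence f x = 0)"

text \<open>In the following, \<open>a i k\<close> is the coefficient of the monomial
  \<open>mpower x k\<close> in the \<open>i\<close>-th component; only its values for
  \<open>k \<in> mindices 1 d\<close> matter.\<close>

definition poly_field :: "nat \<Rightarrow> ('n::finite \<Rightarrow> 'n mindex \<Rightarrow> real) \<Rightarrow> real ^ 'n \<Rightarrow> real ^ 'n"
  where "poly_field d a x = (\<chi> i. \<Sum>k\<in>mindices 1 d. a i k * mpower x k)"

definition diagonal_coeffs :: "nat \<Rightarrow> ('n::finite \<Rightarrow> 'n mindex \<Rightarrow> real) \<Rightarrow> bool"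
  where "diagonal_coeffs d a \<longleftrightarrow> (\<forall>i. \<forall>k\<in>mindices 1 d. a i k \<noteq> 0 \<longrightarrow> k $ i \<noteq> 0)"

definition mono_field :: "('n::finite \<Rightarrow> real) \<Rightarrow> 'n mindex \<Rightarrow> real ^ 'n \<Rightarrow> real ^ 'n"
  where "mono_field c j x = (\<chi> i. c i * x $ i * mpower x j)"

end

theory Submission
  imports Defs
begin

text \<open>Because \<open>f\<close> is diagonal, shifting \<open>k = j + e\<^sub>i\<close> collects its terms into the fields
  \<open>(*)\<close>, and the divergence of the \<open>j\<close>-th one is a constant times \<open>x\<^sup>j\<close>. Both remaining claims
  then follow from the linear independence of monomials.\<close>

lemma mpower_add_axis: "mpower x (j + axis i 1) = x $ i * mpower x j"
proof -
  have "mpower x (j + axis i 1) = (\<Prod>l\<in>UNIV. (if l = i then x $ i else 1) * x $ l ^ j $ l)"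
    unfolding mpower_def by (rule prod.cong) (auto simp: axis_def)
  then show ?thesis
    by (simp add: prod.distrib mpower_def)
qed

lemma mdeg_add_axis: "mdeg (j + axis i 1) = Suc (mdeg j)"
  by (simp add: mdeg_def axis_def sum.distrib)

text \<open>Monomials are eigenfunctions of scaling a single coordinate, with eigenvalue
  \<open>s ^ k $ i\<close>; this is what separates different exponents in the independence
  proof.\<close>

lemma mpower_scale_coordinate:
  "mpower (\<chi> l. (if l = i then s else 1) * x $ l) k = s ^ k $ i * mpower x k"
proof -
  have "(\<Prod>l\<in>UNIV. (if l = i then s else 1) ^ k $ l) = (\<Prod>l\<in>UNIV. if l = i then s ^ k $ i else 1)"
    by (rule prod.cong) auto
  then show ?thesis
    by (simp add: mpower_def power_mult_distrib prod.distrib)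
qed

lemma mpower_linear_independent:
  assumes "finite S" and "\<And>x. (\<Sum>k\<in>S. c k * mpower x k) = 0" and "k \<in> S"
  shows "c k = 0"
  using assms
proof (induction S arbitrary: c k rule: finite_induct)
  case (insert l S)
  text \<open>Doubling the \<open>i\<close>-th coordinate and subtracting a multiple of the original relation
    eliminates the monomial \<open>l\<close>.\<close>
  have other: "c k = 0" if k: "k \<in> S" for k
  proof -
    from k insert.hyps obtain i where i: "k $ i \<noteq> l $ i"
      by (metis vec_eq_iff)
    define c' where "c' m = c m * (2 ^ m $ i - 2 ^ l $ i)" for m
    have "(\<Sum>m\<in>S. c' m * mpower x m) = 0" for x
    proof -
      have "(\<Sum>m\<in>insert l S. c m * (2 ^ m $ i * mpower x m)) = 0"
        using insert.prems(1)[of "\<chi> l. (if l = i then 2 else 1) * x $ l"]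
        unfolding mpower_scale_coordinate .
      moreover have "(\<Sum>m\<in>insert l S. 2 ^ l $ i * (c m * mpower x m)) = 0"
        unfolding sum_distrib_left[symmetric] insert.prems(1) by simp
      ultimately have "(\<Sum>m\<in>insert l S. c' m * mpower x m) = 0"
        by (simp only: c'_def left_diff_distrib right_diff_distrib sum_subtractf mult_ac)
      then show ?thesis
        using insert.hyps by (simp add: c'_def)
    qed
    from insert.IH[OF this k] i show ?thesis
      by (simp add: c'_def)
  qed
  \<comment> \<open>Only the term of \<open>l\<close> survives, and every monomial is 1 at the
    all-ones vector.\<close>
  have "c l = 0"
    using insert.prems(1)[of "\<chi> i. 1"] insert.hyps other by (simp add: mpower_def)
  with other insert.prems(2) show ?case by auto
qed simp

text \<open>Writing the exponent as \<open>j + axis i 1\<close> avoids truncated subtraction in the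
  derivative, and the resulting monomial \<open>mpower x j\<close> is the same for every
  \<open>i\<close>.\<close>

lemma mpower_has_partial_derivative:
  "((\<lambda>t. mpower (x + t *\<^sub>R axis i 1) (j + axis i 1)) has_real_derivative
     real (j $ i + 1) * mpower x j) (at 0)"
proof -
  \<comment> \<open>These factors stay constant along the \<open>i\<close>-th direction.\<close>
  let ?R = "\<Prod>l\<in>UNIV - {i}. x $ l ^ j $ l"
  have split: "mpower y k = y $ i ^ k $ i * (\<Prod>l\<in>UNIV - {i}. y $ l ^ k $ l)"
    for y :: "real ^ 'a" and k
    unfolding mpower_def by (rule prod.remove) auto
  have eq: "mpower (x + t *\<^sub>R axis i 1) (j + axis i 1) = (x $ i + t) ^ Suc (j $ i) * ?R" for t
  proof -
    have "(\<Prod>l\<in>UNIV - {i}. (x + t *\<^sub>R axis i 1) $ l ^ (j + axis i 1) $ l) = ?R"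
      by (rule prod.cong) (auto simp: axis_def)
    then show ?thesis
      unfolding split[of "x + t *\<^sub>R axis i 1"] by simp
  qed
  show ?thesis
    unfolding eq split[of x]
    by (rule derivative_eq_intros DERIV_power_Suc refl)+ simp
qed

lemma mono_field_nth: "mono_field c j x $ i = c i * mpower x (j + axis i 1)"
  by (simp add: mono_field_def mpower_add_axis mult.assoc del: One_nat_def)

text \<open>All components of the \<open>j\<close>-th field contribute multiples of the same
  monomial, so interchanging the sums sorts the divergence by monomials.\<close>

lemma divergence_sum_mono_field:
  "divergence (\<lambda>x. \<Sum>j\<in>J. mono_field (c j) j x) x =
    (\<Sum>j\<in>J. (\<Sum>i\<in>UNIV. c j i * real (j $ i + 1)) * mpower x j)"
proof -
  have "partial_deriv i (\<lambda>y. (\<Sum>j\<in>J. mono_field (c j) j y) $ i) x =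
      (\<Sum>j\<in>J. c j i * (real (j $ i + 1) * mpower x j))" for i
    unfolding partial_deriv_def sum_component mono_field_nth
    by (intro DERIV_imp_deriv DERIV_sum DERIV_cmult mpower_has_partial_derivative)
  then have "divergence (\<lambda>x. \<Sum>j\<in>J. mono_field (c j) j x) x =
      (\<Sum>i\<in>UNIV. \<Sum>j\<in>J. c j i * (real (j $ i + 1) * mpower x j))"
    by (simp add: divergence_def)
  also have "\<dots> = (\<Sum>j\<in>J. (\<Sum>i\<in>UNIV. c j i * real (j $ i + 1)) * mpower x j)"
    by (subst sum.swap) (simp only: sum_distrib_right mult.assoc)
  finally show ?thesis .
qed

lemma divergence_mono_field:
  "divergence (mono_field c j) x = (\<Sum>i\<in>UNIV. c i * real (j $ i + 1)) * mpower x j"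
  using divergence_sum_mono_field[of "\<lambda>_. c" "{j}" x] by simp

text \<open>The exponents of component \<open>i\<close> that are not of the form
  \<open>j + axis i 1\<close> have \<open>i\<close>-th entry 0, and diagonality makes their
  coefficients vanish.\<close>

lemma poly_field_diagonal_eq_sum_mono_field:
  fixes a :: "'n::finite \<Rightarrow> 'n mindex \<Rightarrow> real"
  assumes "d \<ge> 1" and diag: "diagonal_coeffs d a"
  shows "poly_field d a x = (\<Sum>j\<in>mindices 0 (d - 1). mono_field (\<lambda>i. a i (j + axis i 1)) j x)"
proof (subst vec_eq_iff, rule allI)
  fix i :: 'n
  let ?T = "(\<lambda>j. j + axis i 1) ` mindices 0 (d - 1)"
  \<comment> \<open>Here \<open>d \<ge> 1\<close> matters: subtraction truncates, so
    \<open>Suc (d - 1) \<le> d\<close> fails for \<open>d = 0\<close>.\<close>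
  have sub: "?T \<subseteq> mindices 1 d"
    using assms(1) by (auto simp: mindices_def mdeg_add_axis simp del: One_nat_def)
  have zero: "a i k * mpower x k = 0" if k: "k \<in> mindices 1 d - ?T" for k
  proof (rule ccontr)
    assume "a i k * mpower x k \<noteq> 0"
    with diag k have ki: "k $ i \<noteq> 0"
      by (auto simp: diagonal_coeffs_def)
    \<comment> \<open>By \<open>ki\<close> the truncated subtraction is exact at \<open>i\<close>,
      the only entry that changes.\<close>
    define j where "j = (\<chi> l. k $ l - axis i 1 $ l)"
    from ki have kj: "k = j + axis i 1"
      by (auto simp: vec_eq_iff j_def axis_def)
    moreover from k have "mdeg k \<le> d"
      by (simp add: mindices_def)
    ultimately have "j \<in> mindices 0 (d - 1)"
      by (simp add: mindices_def mdeg_add_axis del: One_nat_def)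
    with kj k show False by blast
  qed
  have "poly_field d a x $ i = (\<Sum>k\<in>?T. a i k * mpower x k)"
    unfolding poly_field_def vec_lambda_beta
    using zero by (intro sum.mono_neutral_right[OF finite_mindices sub]) blast
  also have "\<dots> = (\<Sum>j\<in>mindices 0 (d - 1). a i (j + axis i 1) * mpower x (j + axis i 1))"
    by (subst sum.reindex) (auto intro: inj_onI)
  finally show "poly_field d a x $ i =
      (\<Sum>j\<in>mindices 0 (d - 1). mono_field (\<lambda>i. a i (j + axis i 1)) j x) $ i"
    by (simp add: mono_field_nth)
qed

text \<open>Within one component, distinct \<open>j\<close> give distinct monomials
  \<open>mpower x (j + axis i 1)\<close>, so their coefficients can be compared.\<close>

lemma sum_mono_field_eqD:
  assumes "finite J"
    and eq: "\<And>x. (\<Sum>j\<in>J. mono_field (b j) j x) = (\<Sum>j\<in>J. mono_field (c j) j x)"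
    and "j \<in> J"
  shows "b j = c j"
proof
  fix i
  \<comment> \<open>Subtracting \<open>axis i 1\<close> recovers \<open>j\<close>, so the
    coefficients become indexed by the exponents themselves, as independence requires.\<close>
  have "(\<Sum>k\<in>(\<lambda>j. j + axis i 1) ` J. (b (k - axis i 1) i - c (k - axis i 1) i) * mpower x k) = 0" for x
  proof -
    have "(\<Sum>j\<in>J. b j i * mpower x (j + axis i 1)) = (\<Sum>j\<in>J. c j i * mpower x (j + axis i 1))"
      using arg_cong[OF eq[of x], of "\<lambda>v. v $ i"] by (simp add: mono_field_nth)
    then show ?thesis
      by (subst sum.reindex) (auto intro: inj_onI simp: left_diff_distrib sum_subtractf)
  qed
  from mpower_linear_independent[OF _ this, of "j + axis i 1"] assms(1,3)
  show "b j i = c j i" by simp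
qed

theorem lemma1:
  fixes d :: nat
    and a :: "'n::finite \<Rightarrow> 'n mindex \<Rightarrow> real"
    and f :: "real ^ 'n \<Rightarrow> real ^ 'n"
    and p :: "'n mindex \<Rightarrow> real"
  assumes "d \<ge> 1"
    and "f = poly_field d a"
    and "diagonal_coeffs d a"
    and "divergence_free f"
    and "\<And>x. divergence f x = (\<Sum>j\<in>mindices 0 (d - 1). p j * mpower x j)"
  shows "(\<forall>j\<in>mindices 0 (d - 1). divergence_free (mono_field (\<lambda>i. a i (j + axis i 1)) j)) \<and>
    (\<forall>x. f x = (\<Sum>j\<in>mindices 0 (d - 1). mono_field (\<lambda>i. a i (j + axis i 1)) j x)) \<and>
    (\<forall>G :: 'n mindex \<Rightarrow> real ^ 'n \<Rightarrow> real ^ 'n.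
      (\<forall>j\<in>mindices 0 (d - 1). \<exists>c :: 'n \<Rightarrow> real. G j = mono_field c j) \<longrightarrow>
      (\<forall>x. f x = (\<Sum>j\<in>mindices 0 (d - 1). G j x)) \<longrightarrow>
      (\<forall>j\<in>mindices 0 (d - 1). G j = mono_field (\<lambda>i. a i (j + axis i 1)) j))"
proof (intro conjI allI impI ballI)
  let ?J = "mindices 0 (d - 1) :: 'n mindex set"
  let ?c = "\<lambda>j i. a i (j + axis i 1)"
  have split: "f x = (\<Sum>j\<in>?J. mono_field (?c j) j x)" for x
    using poly_field_diagonal_eq_sum_mono_field assms(1-3) by blast
  show "f x = (\<Sum>j\<in>?J. mono_field (?c j) j x)" for x
    by (rule split)
  show "divergence_free (mono_field (?c j) j)" if "j \<in> ?J" for j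
  proof -
    have "f = (\<lambda>x. \<Sum>j\<in>?J. mono_field (?c j) j x)"
      using split by (rule ext)
    \<comment> \<open>The coefficient of \<open>mpower x j\<close> here is also the constant factor
      in the divergence of the \<open>j\<close>-th field alone, so its vanishing makes that field
      divergence-free.\<close>
    with assms(4) have "(\<Sum>j\<in>?J. (\<Sum>i\<in>UNIV. ?c j i * real (j $ i + 1)) * mpower x j) = 0" for x
      unfolding divergence_free_def by (simp only: divergence_sum_mono_field)
    from mpower_linear_independent[OF finite_mindices this that]
    show ?thesis
      unfolding divergence_free_def divergence_mono_field by simp
  qed
  show "G j = mono_field (?c j) j"
    if form: "\<forall>j\<in>?J. \<exists>c. G j = mono_field c j" and sum: "\<forall>x. f x = (\<Sum>j\<in>?J. G j x)"
      and j: "j \<in> ?J"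
    for G :: "'n mindex \<Rightarrow> real ^ 'n \<Rightarrow> real ^ 'n" and j
  proof -
    from form obtain b where b: "\<And>j. j \<in> ?J \<Longrightarrow> G j = mono_field (b j) j"
      by metis
    have "(\<Sum>j\<in>?J. mono_field (b j) j x) = (\<Sum>j\<in>?J. mono_field (?c j) j x)" for x
      using sum split[of x] b by simp
    from sum_mono_field_eqD[where b = b and c = ?c, OF finite_mindices this j]
    show ?thesis
      using b[OF j] by simp
  qed
qed

end
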